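(* Let $\tau\in\mathcal{H}_g$, $v\in\mathbb{R}^g$, $R\in\mathbb{R}_{\geq0}$ and $p\in\mathbb{R}_{\ge0}$. For every $A\in \mathbb{R}_{\geq 0}$ such that $A+R^2\geq p$, we have \[ \sum_{n\in \mathbb{Z}^g\setminus \mathcal{E}(v,R,\tau)} \big(A + \|n - v\|_\tau^2\big)^{p/2} \exp\big(-\|n - v\|_\tau^2\big) \leq \Big(1 + \sqrt{\tfrac 8\pi}\,\Big) \max\{2,R\}^{g-1} (A + R^2)^{p/2} \exp(- R^2) \prod_{j=1}^{g} \Big(1 + \frac{\sqrt{2\pi}}{c_j}\Big). \] In particular, if $R^2\geq p$, then \[ \Sigma(v,R,p,\tau)\leq \Big(1 + \sqrt{\tfrac 8\pi}\,\Big) \max\{2,R\}^{g-1} R^p \exp(- R^2) \prod_{j=1}^{g} \Big(1 + \frac{\sqrt{2\pi}}{c_j}\Big). \]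
   Context: $\mathcal{H}_g$ is the set of symmetric complex $g\times g$ matrices with positive definite imaginary part. For $\tau\in\mathcal{H}_g$ let $Y=\operatorname{Im}(\tau)$ and let $C$ be the unique upper-triangular matrix with positive diagonal entries $c_1,\dots,c_g$ such that $\pi Y=C^TC$. For $x\in\mathbb{R}^g$, $\|x\|_\tau=\sqrt{\pi x^TYx}$, and $\mathcal{E}(v,R,\tau)=\{x\in\mathbb{R}^g:\|x-v\|_\tau<R\}$. The tail sum is $\Sigma(v,R,p,\tau)=\sum_{n\in\mathbb{Z}^g\setminus\mathcal{E}(v,R,\tau)}\|n-v\|_\tau^p\exp(-\|n-v\|_\tau^2)$. *)

theory Defs
  imports "HOL-Analysis.Analysis"
begin

definition Im_mat :: "complex^'n^'m \<Rightarrow> real^'n^'m" where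
  "Im_mat \<tau> = (\<chi> i j. Im (\<tau> $ i $ j))"

definition pos_def :: "real^'n^'n \<Rightarrow> bool" where
  "pos_def Y \<longleftrightarrow> (\<forall>x. x \<noteq> 0 \<longrightarrow> x \<bullet> (Y *v x) > 0)"

definition siegel_space :: "(complex^'g^'g) set" where
  "siegel_space = {\<tau>. transpose \<tau> = \<tau> \<and> pos_def (Im_mat \<tau>)}"

text \<open>The index type carries a linear order so that triangularity makes sense.
  For \<open>\<tau>\<close> in the Siegel space exactly one such \<open>C\<close> exists (Cholesky decomposition).\<close>

definition upper_triangular :: "real^('g::{finite,linorder})^('g::{finite,linorder}) \<Rightarrow> bool" where
  "upper_triangular C \<longleftrightarrow> (\<forall>i j. j < i \<longrightarrow> C $ i $ j = 0)"

definition cholesky_factor :: "complex^('g::{finite,linorder})^('g::{finite,linorder}) \<Rightarrow> real^('g::{finite,linorder})^('g::{finite,linorder}) \<Rightarrow> bool" where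
  "cholesky_factor \<tau> C \<longleftrightarrow>
     upper_triangular C \<and> (\<forall>j. C $ j $ j > 0) \<and> pi *\<^sub>R Im_mat \<tau> = transpose C ** C"

definition tau_norm :: "complex^'g^'g \<Rightarrow> real^'g \<Rightarrow> real" where
  "tau_norm \<tau> x = sqrt (pi * (x \<bullet> (Im_mat \<tau> *v x)))"

definition ellipsoid :: "real^'g \<Rightarrow> real \<Rightarrow> complex^'g^'g \<Rightarrow> (real^'g) set" where
  "ellipsoid v R \<tau> = {x. tau_norm \<tau> (x - v) < R}"

definition int_vectors :: "(real^'g) set" where
  "int_vectors = {n. \<forall>i. n $ i \<in> \<int>}"

text \<open>Powers with a nonnegative base and a nonnegative real exponent, with the usual
  convention that \<open>0\<close> to the power \<open>0\<close> is \<open>1\<close>; in contrast, \<open>0 powr 0 = 0\<close>.\<close>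

definition rpow :: "real \<Rightarrow> real \<Rightarrow> real" where
  "rpow x p = (if p = 0 then 1 else x powr p)"

text \<open>\<open>infsum\<close> is \<open>0\<close> on families that are not summable, so an upper bound on
  \<open>tail_sum\<close> is only meaningful together with summability.\<close>

definition tail_term :: "real^'g \<Rightarrow> real \<Rightarrow> complex^'g^'g \<Rightarrow> real^'g \<Rightarrow> real" where
  "tail_term v p \<tau> n = rpow (tau_norm \<tau> (n - v)) p * exp (- (tau_norm \<tau> (n - v))\<^sup>2)"

definition tail_sum :: "real^'g \<Rightarrow> real \<Rightarrow> real \<Rightarrow> complex^'g^'g \<Rightarrow> real" where
  "tail_sum v R p \<tau> = infsum (tail_term v p \<tau>) (int_vectors - ellipsoid v R \<tau>)"

end

theory Submission
  imports Defs "HOL-Probability.Distributions"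
begin

text \<open>As \<open>A + R\<^sup>2 \<ge> p\<close>, the function \<open>(A + r\<^sup>2)\<close> to the power \<open>p / 2\<close> times \<open>exp (- r\<^sup>2 / 2)\<close> is
  nonincreasing for \<open>r \<ge> R\<close>. Splitting this factor off leaves a tail of the Gaussian sum of
  \<open>exp (- \<parallel>C (n - v)\<parallel>\<^sup>2 / 2)\<close>, which is bounded one coordinate at a time, the last coordinate being
  the outermost. Since \<open>C\<close> is triangular, the last component \<open>t\<close> of \<open>C (n - v)\<close> depends only on the
  last coordinate \<open>n\<^sub>b\<close> of \<open>n\<close> and runs through an arithmetic progression of step \<open>c\<^sub>b\<close>. If \<open>\<bar>t\<bar> \<ge> R\<close>, the inner
  sum is bounded by the full Gaussian sum in one dimension less; if \<open>\<bar>t\<bar> < R\<close>, it is a tail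
  outside radius \<open>sqrt (R\<^sup>2 - t\<^sup>2)\<close>, which contributes at most a multiple of \<open>exp (- R\<^sup>2 / 2)\<close> independent
  of \<open>t\<close>, and there are at most \<open>1 + 2 R / c\<^sub>b\<close> such values of \<open>t\<close>. The one-dimensional sums are
  compared with the Gaussian integral.\<close>

section \<open>Tail integrals of the Gaussian\<close>

definition gauss_tail :: "real \<Rightarrow> real" where
  "gauss_tail a = (LINT u:{a<..}|lborel. exp (- u\<^sup>2 / 2))"

lemma gauss_integrable: "integrable lborel (\<lambda>u::real. exp (- u\<^sup>2 / 2))"
  and gauss_integral: "(LINT u|lborel. exp (- u\<^sup>2 / 2)) = sqrt (2 * pi)"
proof -
  have eq: "exp (- u\<^sup>2 / 2) = sqrt (2 * pi) * std_normal_density u" for u :: real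
    by (simp add: std_normal_density_def)
  show "integrable lborel (\<lambda>u::real. exp (- u\<^sup>2 / 2))"
    unfolding eq by (intro integrable_mult_right integrable_normal_moment_nz_1 integrable_normal_density) auto
  show "(LINT u|lborel. exp (- u\<^sup>2 / 2)) = sqrt (2 * pi)"
    unfolding eq by (simp add: integral_normal_density)
qed

lemma gauss_set_integrable:
  "S \<in> sets lborel \<Longrightarrow> set_integrable lborel S (\<lambda>u::real. exp (- u\<^sup>2 / 2))"
  by (rule set_integrable_subset[of _ UNIV])
     (use gauss_integrable in \<open>auto simp: set_integrable_def\<close>)

lemma gauss_tail_nonneg: "gauss_tail a \<ge> 0"
  unfolding gauss_tail_def set_lebesgue_integral_def
  by (intro integral_nonneg_AE) (auto simp: indicator_def)

lemma gauss_tail_diff: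
  assumes "x \<le> y"
  shows "gauss_tail x = gauss_tail y + (LINT u:{x<..y}|lborel. exp (- u\<^sup>2 / 2))"
proof -
  have "(LINT u:{y<..} \<union> {x<..y}|lborel. exp (- u\<^sup>2 / 2))
      = gauss_tail y + (LINT u:{x<..y}|lborel. exp (- u\<^sup>2 / 2))"
    unfolding gauss_tail_def
    by (rule set_integral_Un[OF _ gauss_set_integrable gauss_set_integrable]) auto
  moreover have "{y<..} \<union> {x<..y} = {x<..}" using assms by auto
  ultimately show ?thesis by (simp add: gauss_tail_def)
qed

lemma gauss_tail_antimono:
  assumes "x \<le> y"
  shows "gauss_tail y \<le> gauss_tail x"
proof -
  have "(LINT u:{x<..y}|lborel. exp (- u\<^sup>2 / 2)) \<ge> (0::real)"
    unfolding set_lebesgue_integral_def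
    by (intro integral_nonneg_AE) (auto simp: indicator_def)
  with gauss_tail_diff[OF assms] show ?thesis by simp
qed

text \<open>For \<open>t \<ge> c / 2\<close> every point between \<open>t - c\<close> and
  \<open>t\<close> has absolute value at most \<open>t\<close>, so the integrand is smallest at
  \<open>t\<close>; the interval may reach across 0.\<close>

lemma gauss_tail_step:
  assumes "0 \<le> c" "t \<ge> c / 2"
  shows "c * exp (- t\<^sup>2 / 2) \<le> gauss_tail (t - c) - gauss_tail t"
proof -
  have "c * exp (- t\<^sup>2 / 2) = (LINT u:{t - c<..t}|lborel. exp (- t\<^sup>2 / 2))"
    using assms by (simp add: set_lebesgue_integral_def)
  also have "\<dots> \<le> (LINT u:{t - c<..t}|lborel. exp (- u\<^sup>2 / 2))"
  proof (rule set_integral_mono)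
    show "set_integrable lborel {t - c<..t} (\<lambda>u. exp (- t\<^sup>2 / 2))"
      using assms by (auto simp: set_integrable_def)
    show "set_integrable lborel {t - c<..t} (\<lambda>u. exp (- u\<^sup>2 / 2))"
      by (intro gauss_set_integrable) auto
    fix u assume "u \<in> {t - c<..t}"
    then have "\<bar>u\<bar> \<le> \<bar>t\<bar>" using assms by auto
    then show "exp (- t\<^sup>2 / 2) \<le> exp (- u\<^sup>2 / 2)"
      by (simp add: abs_le_square_iff)
  qed
  finally show ?thesis using gauss_tail_diff[of "t - c" t] assms by simp
qed

text \<open>Reflection turns \<open>gauss_tail (- a)\<close> into the integral over
  \<open>{..<a}\<close>, which is disjoint from \<open>{a<..}\<close>; together they stay below the
  whole Gaussian integral.\<close>

lemma gauss_tail_symmetric: "gauss_tail a + gauss_tail (- a) \<le> sqrt (2 * pi)"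
proof -
  let ?f = "\<lambda>u::real. exp (- u\<^sup>2 / 2)"
  have reflect: "gauss_tail (- a) = (LINT u:{..<a}|lborel. ?f u)"
    unfolding gauss_tail_def set_lebesgue_integral_def
    by (subst lborel_integral_real_affine[where c = "-1" and t = 0])
       (auto intro!: Bochner_Integration.integral_cong simp: indicator_def)
  have "gauss_tail a + gauss_tail (- a) = (LINT u:{a<..} \<union> {..<a}|lborel. ?f u)"
    unfolding reflect unfolding gauss_tail_def
    by (rule set_integral_Un[symmetric, OF _ gauss_set_integrable gauss_set_integrable]) auto
  also have "\<dots> \<le> (LINT u|lborel. ?f u)"
    unfolding set_lebesgue_integral_def
    by (rule integral_mono)
       (use gauss_set_integrable[of "{a<..} \<union> {..<a}"] gauss_integrable in
         \<open>auto simp: set_integrable_def indicator_def\<close>)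
  finally show ?thesis unfolding gauss_integral .
qed

section \<open>One-dimensional Gaussian sums over arithmetic progressions\<close>

text \<open>The estimates of \<open>gauss_tail_step\<close> telescope. The start may lie as low as
  \<open>- c / 2\<close>, since the next point is then still at least \<open>c / 2\<close>.\<close>

lemma gauss_sum_above:
  fixes T :: "int set" and c a :: real
  assumes "c > 0" "finite T" "c * m0 + a \<ge> - c / 2" "\<forall>m\<in>T. m0 < m"
  shows "(\<Sum>m\<in>T. exp (- (c * m + a)\<^sup>2 / 2)) \<le> gauss_tail (c * m0 + a) / c"
proof -
  \<comment> \<open>The bound \<open>M\<close> varies in the induction: once the largest index
    \<open>b\<close> is removed, the others are at most \<open>b - 1\<close>. Skipped indices do no
    harm because \<open>gauss_tail\<close> is nonincreasing.\<close>
  have "c * (\<Sum>m\<in>T. exp (- (c * m + a)\<^sup>2 / 2)) \<le> gauss_tail (c * m0 + a) - gauss_tail (c * M + a)"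
    if "\<forall>m\<in>T. m0 < m \<and> m \<le> M" "m0 \<le> M" for M
    using \<open>finite T\<close> that
  proof (induction T arbitrary: M rule: finite_linorder_max_induct)
    case empty
    then show ?case using \<open>c > 0\<close> by (simp add: gauss_tail_antimono)
  next
    case (insert b T)
    have "c * (\<Sum>m\<in>T. exp (- (c * m + a)\<^sup>2 / 2))
        \<le> gauss_tail (c * m0 + a) - gauss_tail (c * (b - 1) + a)"
      using insert.IH[of "b - 1"] insert.hyps insert.prems by auto
    moreover have "c * exp (- (c * b + a)\<^sup>2 / 2)
        \<le> gauss_tail (c * (b - 1) + a) - gauss_tail (c * b + a)"
    proof -
      have "c * (m0 + 1) \<le> c * b"
        using insert.prems \<open>c > 0\<close> by (intro mult_left_mono) auto
      then have "c * b + a \<ge> c / 2" using assms(3) by (simp add: algebra_simps)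
      then show ?thesis using gauss_tail_step[of c "c * b + a"] \<open>c > 0\<close>
        by (simp add: algebra_simps)
    qed
    moreover have "gauss_tail (c * M + a) \<le> gauss_tail (c * b + a)"
      using insert.prems \<open>c > 0\<close> by (intro gauss_tail_antimono) simp
    moreover have "b \<notin> T" using insert.hyps by auto
    ultimately show ?case using insert.hyps(1) by (simp add: algebra_simps)
  qed
  \<comment> \<open>Inserting \<open>m0\<close> covers empty \<open>T\<close> and secures
    \<open>m0 \<le> M\<close>.\<close>
  from this[of "Max (insert m0 T)"]
  have "c * (\<Sum>m\<in>T. exp (- (c * m + a)\<^sup>2 / 2)) \<le> gauss_tail (c * m0 + a)"
    using assms gauss_tail_nonneg[of "c * Max (insert m0 T) + a"] by force
  then show ?thesis using \<open>c > 0\<close> by (simp add: field_simps)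
qed

text \<open>The smallest point costs at most 1; the later ones are bounded by the integral over the
  positive half-line, at most half of \<open>sqrt (2 * pi)\<close>.\<close>

lemma gauss_sum_nonneg_points:
  fixes T :: "int set" and c a :: real
  assumes "c > 0" "finite T" "\<forall>m\<in>T. c * m + a \<ge> 0"
  shows "(\<Sum>m\<in>T. exp (- (c * m + a)\<^sup>2 / 2)) \<le> 1 + sqrt (2 * pi) / (2 * c)"
proof (cases "T = {}")
  case True
  then show ?thesis using assms by simp
next
  case False
  define m0 where "m0 = Min T"
  have m0: "m0 \<in> T" using False assms by (simp add: m0_def)
  then have a0: "c * m0 + a \<ge> 0" using assms by auto
  have "\<forall>m\<in>T - {m0}. m0 < m"
    using assms(2) by (auto simp: m0_def order_less_le)
  then have "(\<Sum>m\<in>T - {m0}. exp (- (c * m + a)\<^sup>2 / 2)) \<le> gauss_tail (c * m0 + a) / c"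
    using assms a0 by (intro gauss_sum_above) auto
  also have "\<dots> \<le> gauss_tail 0 / c"
    using a0 assms by (intro divide_right_mono gauss_tail_antimono) auto
  also have "\<dots> \<le> (sqrt (2 * pi) / 2) / c"
    using gauss_tail_symmetric[of 0] assms by (intro divide_right_mono) auto
  finally show ?thesis
    using sum.remove[OF assms(2) m0, of "\<lambda>m. exp (- (c * m + a)\<^sup>2 / 2)"]
    by (simp add: add_mono)
qed

lemma gauss_sum_reflect:
  fixes T :: "int set" and c a :: real
  shows "(\<Sum>m\<in>T. exp (- (c * m + a)\<^sup>2 / 2)) = (\<Sum>m\<in>uminus ` T. exp (- (c * m + (- a))\<^sup>2 / 2))"
proof -
  have "(c * real_of_int (- m) + (- a))\<^sup>2 = (c * m + a)\<^sup>2" for m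
    using power2_minus[of "c * m + a"] by (simp add: algebra_simps)
  then show ?thesis by (simp add: sum.reindex)
qed

text \<open>The point nearest to 0 costs at most 1. The points on its two sides cost at most
  \<open>gauss_tail t / c\<close> and \<open>gauss_tail (- t) / c\<close>, whose sum is controlled
  by the full integral.\<close>

lemma gauss_sum_le:
  fixes T :: "int set" and c a :: real
  assumes "c > 0" "finite T"
  shows "(\<Sum>m\<in>T. exp (- (c * m + a)\<^sup>2 / 2)) \<le> 1 + sqrt (2 * pi) / c"
proof -
  let ?f = "\<lambda>m::int. exp (- (c * m + a)\<^sup>2 / 2)"
  \<comment> \<open>Rounding gives \<open>\<bar>t\<bar> \<le> c / 2\<close>, so that
    \<open>t\<close> and \<open>- t\<close> are both admissible starting points for
    \<open>gauss_sum_above\<close>.\<close>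
  define m0 where "m0 = round (- a / c)"
  define t where "t = c * m0 + a"
  have "\<bar>m0 - (- a / c)\<bar> \<le> 1 / 2"
    unfolding m0_def by (rule of_int_round_abs_le)
  moreover have "t = c * (m0 - (- a / c))"
    using assms by (simp add: t_def field_simps)
  ultimately have "\<bar>t\<bar> \<le> c * (1 / 2)"
    using assms by (simp only: abs_mult) (intro mult_mono, auto)
  then have t: "t \<ge> - c / 2" "- t \<ge> - c / 2" by auto
  have right: "sum ?f {m\<in>T. m0 < m} \<le> gauss_tail t / c"
    using assms t unfolding t_def by (intro gauss_sum_above) auto
  have "sum ?f {m\<in>T. m < m0} = (\<Sum>m\<in>(uminus ` {m\<in>T. m < m0} :: int set). exp (- (c * m + (- a))\<^sup>2 / 2))"
    by (rule gauss_sum_reflect)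
  also have "\<dots> \<le> gauss_tail (c * (- m0) + (- a)) / c"
    using gauss_sum_above[of c "uminus ` {m\<in>T. m < m0}" "- m0" "- a"] assms t
    by (simp add: t_def)
  finally have left: "sum ?f {m\<in>T. m < m0} \<le> gauss_tail (- t) / c"
    by (simp add: t_def)
  have mid: "sum ?f (T \<inter> {m0}) \<le> 1"
    by (cases "m0 \<in> T") auto
  have "T = ({m\<in>T. m0 < m} \<union> {m\<in>T. m < m0}) \<union> (T \<inter> {m0})" by auto
  then have "sum ?f T = sum ?f (({m\<in>T. m0 < m} \<union> {m\<in>T. m < m0}) \<union> (T \<inter> {m0}))" by simp
  also have "\<dots> = sum ?f {m\<in>T. m0 < m} + sum ?f {m\<in>T. m < m0} + sum ?f (T \<inter> {m0})"
    using assms by (subst sum.union_disjoint; (subst sum.union_disjoint)?) auto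
  also have "\<dots> \<le> (gauss_tail t + gauss_tail (- t)) / c + 1"
    using left right mid by (simp add: add_divide_distrib)
  also have "\<dots> \<le> sqrt (2 * pi) / c + 1"
    using gauss_tail_symmetric[of t] assms by (intro add_right_mono divide_right_mono) auto
  finally show ?thesis by simp
qed

text \<open>For \<open>y \<ge> R \<ge> 0\<close> the square of \<open>y\<close> is at least
  \<open>R\<^sup>2 + (y - R)\<^sup>2\<close>. This splits off \<open>exp (- R\<^sup>2 / 2)\<close>
  and leaves a progression of nonnegative points, shifted by \<open>R\<close>.\<close>

lemma gauss_sum_right_tail:
  fixes T :: "int set" and c a R :: real
  assumes "c > 0" "finite T" "R \<ge> 0" "\<forall>m\<in>T. c * m + a \<ge> R"
  shows "(\<Sum>m\<in>T. exp (- (c * m + a)\<^sup>2 / 2)) \<le> exp (- R\<^sup>2 / 2) * (1 + sqrt (2 * pi) / (2 * c))"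
proof -
  have "exp (- (c * m + a)\<^sup>2 / 2) \<le> exp (- R\<^sup>2 / 2) * exp (- (c * m + (a - R))\<^sup>2 / 2)" if "m \<in> T" for m
  proof -
    define y where "y = c * m + a"
    have "0 \<le> R * (y - R)" using assms that by (auto simp: y_def)
    then have "- y\<^sup>2 / 2 \<le> - R\<^sup>2 / 2 + - (y - R)\<^sup>2 / 2"
      by (simp add: power2_eq_square field_simps)
    then show ?thesis
      unfolding exp_add[symmetric] by (simp add: y_def add_diff_eq)
  qed
  then have "(\<Sum>m\<in>T. exp (- (c * m + a)\<^sup>2 / 2))
      \<le> (\<Sum>m\<in>T. exp (- R\<^sup>2 / 2) * exp (- (c * m + (a - R))\<^sup>2 / 2))"
    by (rule sum_mono)
  also have "\<dots> = exp (- R\<^sup>2 / 2) * (\<Sum>m\<in>T. exp (- (c * m + (a - R))\<^sup>2 / 2))"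
    by (simp add: sum_distrib_left)
  also have "\<dots> \<le> exp (- R\<^sup>2 / 2) * (1 + sqrt (2 * pi) / (2 * c))"
    using assms by (intro mult_left_mono gauss_sum_nonneg_points) (auto simp: add_diff_eq)
  finally show ?thesis .
qed

text \<open>The two sides of 0 are separate right tails, each with its own extra 1; hence the
  2.\<close>

lemma gauss_sum_tail:
  fixes T :: "int set" and c a R :: real
  assumes "c > 0" "finite T" "R \<ge> 0" "\<forall>m\<in>T. \<bar>c * m + a\<bar> \<ge> R"
  shows "(\<Sum>m\<in>T. exp (- (c * m + a)\<^sup>2 / 2)) \<le> exp (- R\<^sup>2 / 2) * (2 + sqrt (2 * pi) / c)"
proof -
  let ?f = "\<lambda>m::int. exp (- (c * m + a)\<^sup>2 / 2)"
  let ?P = "{m\<in>T. c * m + a \<ge> 0}" and ?N = "{m\<in>T. c * m + a < 0}"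
  have right: "sum ?f ?P \<le> exp (- R\<^sup>2 / 2) * (1 + sqrt (2 * pi) / (2 * c))"
    using assms by (intro gauss_sum_right_tail) auto
  have "sum ?f ?N = (\<Sum>m\<in>uminus ` ?N. exp (- (c * m + (- a))\<^sup>2 / 2))"
    by (rule gauss_sum_reflect)
  also have "\<dots> \<le> exp (- R\<^sup>2 / 2) * (1 + sqrt (2 * pi) / (2 * c))"
    using assms by (intro gauss_sum_right_tail) force+
  finally have left: "sum ?f ?N \<le> exp (- R\<^sup>2 / 2) * (1 + sqrt (2 * pi) / (2 * c))" .
  have "T = ?P \<union> ?N" by auto
  then have "sum ?f T = sum ?f (?P \<union> ?N)" by simp
  also have "\<dots> = sum ?f ?P + sum ?f ?N"
    using assms by (intro sum.union_disjoint) auto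
  also have "\<dots> \<le> exp (- R\<^sup>2 / 2) * (1 + sqrt (2 * pi) / (2 * c)) + exp (- R\<^sup>2 / 2) * (1 + sqrt (2 * pi) / (2 * c))"
    by (intro add_mono left right)
  also have "\<dots> = exp (- R\<^sup>2 / 2) * (2 + sqrt (2 * pi) / c)"
    by (simp add: algebra_simps)
  finally show ?thesis .
qed

lemma card_near_le:
  fixes T :: "int set" and c a R :: real
  assumes "c > 0" "finite T" "R \<ge> 0" "\<forall>m\<in>T. \<bar>c * m + a\<bar> < R"
  shows "card T \<le> 1 + 2 * R / c"
proof (cases "T = {}")
  case True
  then show ?thesis using assms by simp
next
  case False
  have "T \<subseteq> {Min T..Max T}" using assms by auto
  then have "card T \<le> card {Min T..Max T}" by (intro card_mono) auto
  moreover have "Min T \<le> Max T" using False assms by simp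
  ultimately have "card T \<le> real_of_int (Max T) - Min T + 1" by simp
  moreover have "\<bar>c * Min T + a\<bar> < R" "\<bar>c * Max T + a\<bar> < R"
    using False assms by auto
  then have "c * (real_of_int (Max T) - Min T) \<le> 2 * R"
    by (simp add: algebra_simps)
  then have "real_of_int (Max T) - Min T \<le> 2 * R / c"
    using assms by (simp add: field_simps)
  ultimately show ?thesis by linarith
qed

section \<open>The full Gaussian lattice sum, one coordinate at a time\<close>

text \<open>Varying \<open>I\<close> lowers the rank in an induction while the vector type stays
  fixed; \<open>I = UNIV\<close> gives the squared Euclidean norm of
  \<open>C *v (n - v)\<close>.\<close>

definition partial_form :: "real^'g^'g \<Rightarrow> real^'g \<Rightarrow> 'g set \<Rightarrow> real^'g \<Rightarrow> real" where
  "partial_form C v I n = (\<Sum>j\<in>I. ((C *v (n - v)) $ j)\<^sup>2)"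

text \<open>Row \<open>b\<close> of \<open>C\<close> vanishes on the columns in \<open>I\<close>,
  and outside \<open>insert b I\<close> the coordinates are frozen at those of \<open>w\<close>.
  Hence the component is affine in \<open>n $ b\<close>.\<close>

lemma upper_triangular_last_component:
  fixes C :: "real^('g::{finite,linorder})^('g::{finite,linorder})"
  assumes "upper_triangular C" "\<forall>k\<in>I. k < b" "\<forall>k\<in>- insert b I. n $ k = w $ k"
  shows "(C *v (n - v)) $ b = C $ b $ b * n $ b + ((C *v (w - v)) $ b - C $ b $ b * w $ b)"
proof -
  have "C $ b $ k * (n $ k - v $ k)
      = C $ b $ k * (w $ k - v $ k) + (if k = b then C $ b $ b * (n $ b - w $ b) else 0)" for k
    using assms by (cases "k \<in> I"; cases "k = b")
      (auto simp: upper_triangular_def algebra_simps)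
  then have "(C *v (n - v)) $ b = (C *v (w - v)) $ b + C $ b $ b * (n $ b - w $ b)"
    by (simp add: matrix_vector_mult_def sum.distrib)
  then show ?thesis by (simp add: right_diff_distrib)
qed

lemma partial_gauss_sum_le:
  fixes C :: "real^('g::{finite,linorder})^('g::{finite,linorder})"
  assumes "upper_triangular C" "\<forall>j. C $ j $ j > 0"
    and "finite F" "F \<subseteq> int_vectors" "\<forall>n\<in>F. \<forall>k\<in>- I. n $ k = w $ k"
  shows "(\<Sum>n\<in>F. exp (- partial_form C v I n / 2)) \<le> (\<Prod>j\<in>I. 1 + sqrt (2 * pi) / C $ j $ j)"
  using finite[of I] assms(3-)
proof (induction I arbitrary: F w rule: finite_linorder_max_induct)
  case empty
  then have "F \<subseteq> {w}" by (auto simp: vec_eq_iff)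
  then have "card F \<le> 1" using card_mono[of "{w}" F] by simp
  then show ?case by (simp add: partial_form_def)
next
  case (insert b I)
  let ?c = "C $ b $ b" and ?key = "\<lambda>n. \<lfloor>(n $ b) :: real\<rfloor>"
  let ?P = "\<Prod>j\<in>I. 1 + sqrt (2 * pi) / C $ j $ j"
  define a where "a = (C *v (w - v)) $ b - ?c * w $ b"
  have "b \<notin> I" using insert.hyps by auto
  have P: "?P \<ge> 0" using assms(2) by (intro prod_nonneg) (auto simp: less_imp_le)
  have form: "partial_form C v (insert b I) n = (?c * ?key n + a)\<^sup>2 + partial_form C v I n"
    if "n \<in> F" for n
  proof -
    have "n $ b = ?key n" using that insert.prems by (auto simp: int_vectors_def)
    with upper_triangular_last_component[OF assms(1), of I b n w v] that insert
    show ?thesis using \<open>b \<notin> I\<close> by (simp add: partial_form_def a_def)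
  qed
  have "(\<Sum>n\<in>F. exp (- partial_form C v (insert b I) n / 2))
      = (\<Sum>m\<in>?key ` F. \<Sum>n\<in>{n\<in>F. ?key n = m}. exp (- partial_form C v (insert b I) n / 2))"
    by (rule sum.image_gen[OF insert.prems(1)])
  also have "\<dots> = (\<Sum>m\<in>?key ` F. exp (- (?c * m + a)\<^sup>2 / 2)
      * (\<Sum>n\<in>{n\<in>F. ?key n = m}. exp (- partial_form C v I n / 2)))"
    by (auto intro!: sum.cong simp: sum_distrib_left form exp_add[symmetric] diff_divide_distrib)
  also have "\<dots> \<le> (\<Sum>m\<in>?key ` F. exp (- (?c * m + a)\<^sup>2 / 2) * ?P)"
  proof (intro sum_mono mult_left_mono)
    fix m :: int
    show "(\<Sum>n\<in>{n\<in>F. ?key n = m}. exp (- partial_form C v I n / 2)) \<le> ?P"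
    proof (rule insert.IH[where w = "\<chi> k. if k = b then of_int m else w $ k"])
      show "\<forall>n\<in>{n\<in>F. ?key n = m}. \<forall>k\<in>- I. n $ k = (\<chi> k. if k = b then of_int m else w $ k) $ k"
        using insert.prems by (auto simp: int_vectors_def)
    qed (use insert.prems in auto)
  qed auto
  also have "\<dots> = (\<Sum>m\<in>?key ` F. exp (- (?c * m + a)\<^sup>2 / 2)) * ?P"
    by (simp add: sum_distrib_right)
  also have "\<dots> \<le> (1 + sqrt (2 * pi) / ?c) * ?P"
    using P assms insert.prems by (intro mult_right_mono gauss_sum_le) auto
  also have "\<dots> = (\<Prod>j\<in>insert b I. 1 + sqrt (2 * pi) / C $ j $ j)"
    using \<open>b \<notin> I\<close> insert.hyps by simp
  finally show ?case .
qed

section \<open>The Gaussian lattice sum outside a ball\<close>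

text \<open>The value \<open>0\<close> in rank \<open>0\<close> is what makes the induction step uniform: the form is \<open>0\<close> there,
  so the part of the sum outside a ball of positive radius is empty.\<close>

definition tail_coeff :: "nat \<Rightarrow> real \<Rightarrow> real" where
  "tail_coeff k R = (if k = 0 then 0 else (1 + sqrt (8 / pi)) * max 2 R ^ (k - 1))"

lemma tail_coeff_nonneg: "tail_coeff k R \<ge> 0"
  by (simp add: tail_coeff_def)

lemma tail_coeff_mono: "R \<le> R' \<Longrightarrow> tail_coeff k R \<le> tail_coeff k R'"
  unfolding tail_coeff_def by (auto intro!: mult_left_mono power_mono)

lemma sqrt_8_over_pi: "sqrt (8 / pi) \<ge> 3 / 2"
  by (rule real_le_rsqrt) (use pi_approx in \<open>simp add: field_simps\<close>)

lemma sqrt_2_pi: "sqrt (2 * pi) \<ge> 5 / 2"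
  by (rule real_le_rsqrt) (use pi_approx in \<open>simp add: field_simps\<close>)

text \<open>The recursion behind the constants: the far layers give
  \<open>2 + sqrt (2 * pi) / c\<close>, and each of the at most \<open>1 + 2 * R / c\<close> near
  layers gives \<open>tail_coeff k R\<close>. For positive \<open>k\<close>, constant terms and
  coefficients of \<open>1 / c\<close> are compared separately.\<close>

lemma tail_coeff_Suc:
  assumes "c > 0" "R \<ge> 0"
  shows "2 + sqrt (2 * pi) / c + tail_coeff k R * (1 + 2 * R / c)
    \<le> tail_coeff (Suc k) R * (1 + sqrt (2 * pi) / c)"
proof -
  define K where "K = 1 + sqrt (8 / pi)"
  define s where "s = sqrt (2 * pi)"
  define M where "M = max 2 R"
  have K: "K \<ge> 5 / 2" using sqrt_8_over_pi by (simp add: K_def)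
  have s: "s \<ge> 5 / 2" using sqrt_2_pi by (simp add: s_def)
  have M: "M \<ge> 2" "R \<le> M" by (auto simp: M_def)
  show ?thesis
  proof (cases k)
    case 0
    have "s / c \<le> K * (s / c)" using mult_right_mono[of 1 K "s / c"] K s assms by simp
    then show ?thesis using 0 K
      by (simp add: tail_coeff_def K_def[symmetric] s_def[symmetric] distrib_left)
  next
    case (Suc l)
    have const: "2 + K \<le> K * M"
    proof -
      have "K * 2 \<le> K * M" using K M by (intro mult_left_mono) auto
      then show ?thesis using K by linarith
    qed
    have lin: "s + K * (2 * R) \<le> K * M * s"
    proof -
      have "2 * (s - 2) \<le> M * (s - 2)" using M s by (intro mult_right_mono) auto
      then have "K * (2 * (s - 2)) \<le> K * (M * (s - 2))" using K by (intro mult_left_mono) auto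
      \<comment> \<open>For \<open>M = 2\<close> the claim reads
        \<open>s + 4 * K \<le> 2 * K * s\<close>. It follows from this product and the lower bounds
        \<open>5 / 2\<close>, with equality at \<open>K = s = 5 / 2\<close>.\<close>
      moreover have "(K - 5 / 2) * (s - 5 / 2) \<ge> 0" using K s by simp
      ultimately have "s + K * (2 * M) \<le> K * M * s" using K s by (simp add: algebra_simps)
      moreover have "K * (2 * R) \<le> K * (2 * M)" using K M by (intro mult_left_mono) auto
      ultimately show ?thesis by linarith
    qed
    have "2 + s / c + K * (1 + 2 * R / c) = (2 + K) + (s + K * (2 * R)) / c"
      by (simp add: add_divide_distrib distrib_left)
    also have "\<dots> \<le> K * M + K * M * s / c"
      using const lin assms by (intro add_mono divide_right_mono) auto
    finally have main: "2 + s / c + K * (1 + 2 * R / c) \<le> K * M * (1 + s / c)"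
      by (simp add: distrib_left)
    \<comment> \<open>Enlarging the far contribution by \<open>M ^ l\<close> makes this power a
      common factor.\<close>
    have "1 \<le> M ^ l" using M by (intro one_le_power) auto
    then have "1 * (2 + s / c) \<le> M ^ l * (2 + s / c)"
      using s assms by (intro mult_right_mono) auto
    then have "2 + s / c + K * M ^ l * (1 + 2 * R / c) \<le> M ^ l * (2 + s / c + K * (1 + 2 * R / c))"
      by (simp add: algebra_simps)
    also have "\<dots> \<le> M ^ l * (K * M * (1 + s / c))"
      using main M by (intro mult_left_mono) auto
    finally show ?thesis
      using Suc unfolding tail_coeff_def K_def[symmetric] s_def[symmetric] M_def[symmetric]
      by (simp add: ac_simps)
  qed
qed

text \<open>\<open>R\<close> varies in the induction because a near layer leaves a tail of smaller
  radius; far layers are covered by \<open>partial_gauss_sum_le\<close>.\<close>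

lemma partial_gauss_tail_le:
  fixes C :: "real^('g::{finite,linorder})^('g::{finite,linorder})"
  assumes "upper_triangular C" "\<forall>j. C $ j $ j > 0" "R > 0"
    and "finite F" "F \<subseteq> int_vectors" "\<forall>n\<in>F. \<forall>k\<in>- I. n $ k = w $ k"
    and "\<forall>n\<in>F. R\<^sup>2 \<le> partial_form C v I n"
  shows "(\<Sum>n\<in>F. exp (- partial_form C v I n / 2))
    \<le> tail_coeff (card I) R * exp (- R\<^sup>2 / 2) * (\<Prod>j\<in>I. 1 + sqrt (2 * pi) / C $ j $ j)"
  using finite[of I] assms(3-)
proof (induction I arbitrary: F w R rule: finite_linorder_max_induct)
  case empty
  then have "F = {}" by (fastforce simp: partial_form_def)
  then show ?case by (simp add: tail_coeff_def)
next
  case (insert b I)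
  let ?c = "C $ b $ b" and ?key = "\<lambda>n. \<lfloor>(n $ b) :: real\<rfloor>"
  let ?P = "\<Prod>j\<in>I. 1 + sqrt (2 * pi) / C $ j $ j"
  define a where "a = (C *v (w - v)) $ b - ?c * w $ b"
  define t where "t m = ?c * of_int m + a" for m :: int
  define near where "near = {m \<in> ?key ` F. \<bar>t m\<bar> < R}"
  define far where "far = {m \<in> ?key ` F. \<bar>t m\<bar> \<ge> R}"
  define S where "S m = (\<Sum>n\<in>{n\<in>F. ?key n = m}. exp (- partial_form C v I n / 2))" for m
  have "b \<notin> I" using insert.hyps by auto
  have c: "?c > 0" using assms(2) by auto
  have P: "?P \<ge> 0" using assms(2) by (intro prod_nonneg) (auto simp: less_imp_le)
  have form: "partial_form C v (insert b I) n = (t (?key n))\<^sup>2 + partial_form C v I n"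
    if "n \<in> F" for n
  proof -
    have "n $ b = ?key n" using that insert.prems by (auto simp: int_vectors_def)
    with upper_triangular_last_component[OF assms(1), of I b n w v] that insert
    show ?thesis using \<open>b \<notin> I\<close> by (simp add: partial_form_def a_def t_def)
  qed
  have fiber: "\<forall>n\<in>{n\<in>F. ?key n = m}. \<forall>k\<in>- I. n $ k = (\<chi> k. if k = b then of_int m else w $ k) $ k" for m
    using insert.prems by (auto simp: int_vectors_def)
  have fin: "finite near" "finite far" using insert.prems by (auto simp: near_def far_def)
  have far_le: "(\<Sum>m\<in>far. exp (- (t m)\<^sup>2 / 2) * S m) \<le> exp (- R\<^sup>2 / 2) * (2 + sqrt (2 * pi) / ?c) * ?P"
  proof -
    have "S m \<le> ?P" for m
      unfolding S_def using insert.prems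
      by (intro partial_gauss_sum_le[OF assms(1,2) _ _ fiber]) auto
    then have "(\<Sum>m\<in>far. exp (- (t m)\<^sup>2 / 2) * S m) \<le> (\<Sum>m\<in>far. exp (- (t m)\<^sup>2 / 2) * ?P)"
      by (intro sum_mono mult_left_mono) auto
    also have "\<dots> = (\<Sum>m\<in>far. exp (- (t m)\<^sup>2 / 2)) * ?P"
      by (simp add: sum_distrib_right)
    also have "\<dots> \<le> exp (- R\<^sup>2 / 2) * (2 + sqrt (2 * pi) / ?c) * ?P"
      unfolding t_def using P c fin insert.prems
      by (intro mult_right_mono gauss_sum_tail) (auto simp: far_def t_def)
    finally show ?thesis .
  qed
  have near_le: "(\<Sum>m\<in>near. exp (- (t m)\<^sup>2 / 2) * S m)
      \<le> (1 + 2 * R / ?c) * (tail_coeff (card I) R * exp (- R\<^sup>2 / 2) * ?P)"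
  proof -
    have "exp (- (t m)\<^sup>2 / 2) * S m \<le> tail_coeff (card I) R * exp (- R\<^sup>2 / 2) * ?P" if "m \<in> near" for m
    proof -
      \<comment> \<open>On layer \<open>m\<close> the remaining form is at least
        \<open>R\<^sup>2 - (t m)\<^sup>2\<close>, so \<open>r\<close> is the radius left over. The
        strict inequality in \<open>near\<close> makes it positive, as the induction hypothesis
        demands.\<close>
      define r where "r = sqrt (R\<^sup>2 - (t m)\<^sup>2)"
      have "(t m)\<^sup>2 < R\<^sup>2"
        using that power_strict_mono[of "\<bar>t m\<bar>" R 2] by (simp add: near_def)
      then have r: "r > 0" "r\<^sup>2 = R\<^sup>2 - (t m)\<^sup>2" by (auto simp: r_def)
      have "r \<le> R" using r insert.prems(1) by (auto intro: power2_le_imp_le[of r R])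
      have "S m \<le> tail_coeff (card I) r * exp (- r\<^sup>2 / 2) * ?P"
        unfolding S_def
      proof (rule insert.IH[OF r(1) _ _ fiber])
        show "\<forall>n\<in>{n\<in>F. ?key n = m}. r\<^sup>2 \<le> partial_form C v I n"
          using insert.prems(5) form r by auto
      qed (use insert.prems in auto)
      also have "\<dots> \<le> tail_coeff (card I) R * exp (- r\<^sup>2 / 2) * ?P"
        using P by (intro mult_right_mono tail_coeff_mono \<open>r \<le> R\<close>) auto
      finally have "exp (- (t m)\<^sup>2 / 2) * S m
          \<le> exp (- (t m)\<^sup>2 / 2) * (tail_coeff (card I) R * exp (- r\<^sup>2 / 2) * ?P)"
        by (intro mult_left_mono) auto
      also have "\<dots> = tail_coeff (card I) R * (exp (- (t m)\<^sup>2 / 2) * exp (- r\<^sup>2 / 2)) * ?P"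
        by simp
      \<comment> \<open>The weight of the layer restores what the exponent lost in passing from
        \<open>R\<close> to \<open>r\<close>. All near layers thus share one bound and only need to
        be counted.\<close>
      also have "exp (- (t m)\<^sup>2 / 2) * exp (- r\<^sup>2 / 2) = exp (- R\<^sup>2 / 2)"
        unfolding exp_add[symmetric] r(2) by (simp add: field_simps)
      finally show ?thesis .
    qed
    then have "(\<Sum>m\<in>near. exp (- (t m)\<^sup>2 / 2) * S m)
        \<le> real (card near) * (tail_coeff (card I) R * exp (- R\<^sup>2 / 2) * ?P)"
      by (rule sum_bounded_above)
    also have "\<dots> \<le> (1 + 2 * R / ?c) * (tail_coeff (card I) R * exp (- R\<^sup>2 / 2) * ?P)"
      using P c fin insert.prems tail_coeff_nonneg
      by (intro mult_right_mono card_near_le[where a = a]) (auto simp: near_def t_def)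
    finally show ?thesis .
  qed
  have "(\<Sum>n\<in>F. exp (- partial_form C v (insert b I) n / 2))
      = (\<Sum>m\<in>?key ` F. \<Sum>n\<in>{n\<in>F. ?key n = m}. exp (- partial_form C v (insert b I) n / 2))"
    by (rule sum.image_gen[OF insert.prems(2)])
  also have "\<dots> = (\<Sum>m\<in>?key ` F. exp (- (t m)\<^sup>2 / 2) * S m)"
    by (auto intro!: sum.cong simp: S_def sum_distrib_left form exp_add[symmetric] diff_divide_distrib)
  also have "?key ` F = near \<union> far" by (auto simp: near_def far_def)
  also have "(\<Sum>m\<in>near \<union> far. exp (- (t m)\<^sup>2 / 2) * S m)
      = (\<Sum>m\<in>near. exp (- (t m)\<^sup>2 / 2) * S m) + (\<Sum>m\<in>far. exp (- (t m)\<^sup>2 / 2) * S m)"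
    using fin by (intro sum.union_disjoint) (auto simp: near_def far_def)
  also have "\<dots> \<le> (1 + 2 * R / ?c) * (tail_coeff (card I) R * exp (- R\<^sup>2 / 2) * ?P)
      + exp (- R\<^sup>2 / 2) * (2 + sqrt (2 * pi) / ?c) * ?P"
    by (intro add_mono near_le far_le)
  also have "\<dots> = (2 + sqrt (2 * pi) / ?c + tail_coeff (card I) R * (1 + 2 * R / ?c))
      * (exp (- R\<^sup>2 / 2) * ?P)"
    by (simp add: algebra_simps)
  also have "\<dots> \<le> (tail_coeff (Suc (card I)) R * (1 + sqrt (2 * pi) / ?c)) * (exp (- R\<^sup>2 / 2) * ?P)"
    using P c insert.prems(1) by (intro mult_right_mono tail_coeff_Suc) auto
  also have "\<dots> = tail_coeff (card (insert b I)) R * exp (- R\<^sup>2 / 2)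
      * (\<Prod>j\<in>insert b I. 1 + sqrt (2 * pi) / C $ j $ j)"
    using \<open>b \<notin> I\<close> insert.hyps by simp
  finally show ?case .
qed

lemma gauss_lattice_tail_le:
  fixes C :: "real^('g::{finite,linorder})^('g::{finite,linorder})"
  assumes "upper_triangular C" "\<forall>j. C $ j $ j > 0" "R \<ge> 0"
    and "finite F" "F \<subseteq> int_vectors" "\<forall>n\<in>F. R \<le> norm (C *v (n - v))"
  shows "(\<Sum>n\<in>F. exp (- (norm (C *v (n - v)))\<^sup>2 / 2))
    \<le> (1 + sqrt (8 / pi)) * max 2 R ^ (CARD('g) - 1) * exp (- R\<^sup>2 / 2)
        * (\<Prod>j\<in>UNIV. 1 + sqrt (2 * pi) / C $ j $ j)"
proof -
  have form: "(norm (C *v (n - v)))\<^sup>2 = partial_form C v UNIV n" for n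
    by (simp add: partial_form_def norm_vec_def L2_set_def sum_nonneg)
  let ?P = "\<Prod>j\<in>UNIV. 1 + sqrt (2 * pi) / C $ j $ j"
  show ?thesis
  \<comment> \<open>The tail lemma requires \<open>R > 0\<close>, as its base case would fail at 0.
    For \<open>R = 0\<close> the bound on the full sum suffices, the additional coefficient being at
    least 1.\<close>
  proof (cases "R = 0")
    case True
    have P: "?P \<ge> 0" using assms(2) by (intro prod_nonneg) (auto simp: less_imp_le)
    have "(\<Sum>n\<in>F. exp (- partial_form C v UNIV n / 2)) \<le> ?P"
      using assms by (intro partial_gauss_sum_le) auto
    also have "\<dots> \<le> ((1 + sqrt (8 / pi)) * 2 ^ (CARD('g) - 1)) * ?P"
    proof -
      have "1 * 1 \<le> (1 + sqrt (8 / pi)) * 2 ^ (CARD('g) - 1)"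
        by (intro mult_mono) auto
      from mult_right_mono[OF this P] show ?thesis by simp
    qed
    finally show ?thesis using True by (simp add: form)
  next
    case False
    have "\<forall>n\<in>F. R\<^sup>2 \<le> partial_form C v UNIV n"
      using assms unfolding form[symmetric] by (auto intro!: power_mono)
    then have "(\<Sum>n\<in>F. exp (- partial_form C v UNIV n / 2))
        \<le> tail_coeff CARD('g) R * exp (- R\<^sup>2 / 2) * ?P"
      using assms False by (intro partial_gauss_tail_le) auto
    then show ?thesis by (simp add: form tail_coeff_def)
  qed
qed

section \<open>Splitting off the power factor and passing to infinite sums\<close>

lemma rpow_nonneg: "rpow x p \<ge> 0"
  by (simp add: rpow_def)

text \<open>In the variable \<open>x = A + r\<^sup>2\<close> the logarithm of the product has
  derivative \<open>(p / x - 1) / 2\<close>, nonpositive for \<open>x \<ge> p\<close>. The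
  inequality \<open>ln z \<le> z - 1\<close> at \<open>z = y / x\<close> replaces the
  derivative.\<close>

lemma rpow_exp_antimono:
  assumes "0 \<le> A" "0 \<le> R" "R \<le> r" "0 \<le> p" "p \<le> A + R\<^sup>2"
  shows "rpow (A + r\<^sup>2) (p / 2) * exp (- r\<^sup>2 / 2) \<le> rpow (A + R\<^sup>2) (p / 2) * exp (- R\<^sup>2 / 2)"
\<comment> \<open>\<open>A + R\<^sup>2\<close> can vanish only if \<open>p = 0\<close>; otherwise it
  is at least \<open>p > 0\<close> and has a logarithm.\<close>
proof (cases "p = 0")
  case True
  then show ?thesis using assms by (simp add: rpow_def power_mono)
next
  case False
  define x where "x = A + R\<^sup>2"
  define y where "y = A + r\<^sup>2"
  have R: "R\<^sup>2 \<le> r\<^sup>2" using assms by (intro power_mono) auto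
  have x: "x > 0" "x \<le> y" "p \<le> x" using assms False R by (auto simp: x_def y_def)
  have "ln y - ln x = ln (y / x)" using x by (simp add: ln_div)
  also have "\<dots> \<le> y / x - 1" using x by (intro ln_le_minus_one) auto
  also have "\<dots> = (y - x) / x" using x by (simp add: field_simps)
  finally have "p / 2 * (ln y - ln x) \<le> p / 2 * ((y - x) / x)"
    using assms by (intro mult_left_mono) auto
  also have "\<dots> = (p / x) * ((y - x) / 2)" by simp
  also have "\<dots> \<le> 1 * ((y - x) / 2)"
    using x by (intro mult_right_mono) auto
  finally have "p / 2 * ln y - r\<^sup>2 / 2 \<le> p / 2 * ln x - R\<^sup>2 / 2"
    by (simp add: x_def y_def algebra_simps)
  then have "exp (p / 2 * ln y - r\<^sup>2 / 2) \<le> exp (p / 2 * ln x - R\<^sup>2 / 2)" by simp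
  then show ?thesis
    using x False by (simp add: rpow_def powr_def exp_add[symmetric] x_def[symmetric] y_def[symmetric])
qed

lemma rpow_power2:
  assumes "x \<ge> 0"
  shows "rpow (x\<^sup>2) (p / 2) = rpow x p"
  using assms by (cases "x = 0") (auto simp: rpow_def powr_powr powr_numeral[symmetric] simp del: powr_numeral)

lemma tau_norm_cholesky:
  assumes "cholesky_factor \<tau> C"
  shows "tau_norm \<tau> x = norm (C *v x)"
proof -
  have "pi * (x \<bullet> (Im_mat \<tau> *v x)) = x \<bullet> ((pi *\<^sub>R Im_mat \<tau>) *v x)"
    by (simp add: scaleR_matrix_vector_assoc[symmetric])
  also have "\<dots> = (C *v x) \<bullet> (C *v x)"
    using assms unfolding cholesky_factor_def
    by (simp add: matrix_vector_mul_assoc[symmetric] dot_lmul_matrix[symmetric] inner_commute)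
  finally show ?thesis by (simp add: tau_norm_def norm_eq_sqrt_inner)
qed

text \<open>A nonnegative family sums to the supremum of its finite partial sums, which is why the
  estimates above concern finite sets \<open>F\<close>.\<close>

lemma summable_infsum_le_if_finite_sums_le:
  fixes f :: "'a \<Rightarrow> real"
  assumes "\<And>x. x \<in> S \<Longrightarrow> f x \<ge> 0" "\<And>F. finite F \<Longrightarrow> F \<subseteq> S \<Longrightarrow> sum f F \<le> B"
  shows "f summable_on S \<and> infsum f S \<le> B"
proof -
  have "f summable_on S"
    using assms by (intro nonneg_bdd_above_summable_on) (auto simp: bdd_above_def)
  then show ?thesis using assms(2) by (auto intro: infsum_le_finite_sums)
qed

lemma theta_tail_bound:
  fixes \<tau> :: "complex^('g::{finite,linorder})^('g::{finite,linorder})"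
    and v :: "real^('g::{finite,linorder})"
  assumes chol: "cholesky_factor \<tau> C" and "R \<ge> 0" "p \<ge> 0" "A \<ge> 0" "A + R\<^sup>2 \<ge> p"
  defines "f \<equiv> \<lambda>n. rpow (A + (tau_norm \<tau> (n - v))\<^sup>2) (p / 2) * exp (- (tau_norm \<tau> (n - v))\<^sup>2)"
  shows "f summable_on (int_vectors - ellipsoid v R \<tau>) \<and>
    infsum f (int_vectors - ellipsoid v R \<tau>)
      \<le> (1 + sqrt (8 / pi)) * max 2 R ^ (CARD('g) - 1) * rpow (A + R\<^sup>2) (p / 2)
          * exp (- R\<^sup>2) * (\<Prod>j\<in>UNIV. 1 + sqrt (2 * pi) / C $ j $ j)"
proof (rule summable_infsum_le_if_finite_sums_le)
  show "f n \<ge> 0" for n by (simp add: f_def rpow_nonneg)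
  fix F assume F: "finite F" "F \<subseteq> int_vectors - ellipsoid v R \<tau>"
  let ?r = "\<lambda>n. norm (C *v (n - v))"
  let ?h = "rpow (A + R\<^sup>2) (p / 2) * exp (- R\<^sup>2 / 2)"
  let ?B = "(1 + sqrt (8 / pi)) * max 2 R ^ (CARD('g) - 1) * exp (- R\<^sup>2 / 2)
        * (\<Prod>j\<in>UNIV. 1 + sqrt (2 * pi) / C $ j $ j)"
  have r: "\<forall>n\<in>F. R \<le> ?r n"
    using F by (auto simp: ellipsoid_def tau_norm_cholesky[OF chol] not_less)
  \<comment> \<open>One half of the exponent absorbs the power factor by monotonicity, the other
    drives the Gaussian sum. Each yields \<open>exp (- R\<^sup>2 / 2)\<close>, and the two recombine
    at the end.\<close>
  have split: "exp (- x) = exp (- x / 2) * exp (- x / 2)" for x :: real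
    by (simp add: exp_add[symmetric])
  have "f n \<le> ?h * exp (- (?r n)\<^sup>2 / 2)" if "n \<in> F" for n
    using mult_right_mono[OF rpow_exp_antimono[of A R "?r n" p], of "exp (- (?r n)\<^sup>2 / 2)"] assms(2-5) r that
    by (simp add: f_def tau_norm_cholesky[OF chol] split[of "(?r n)\<^sup>2"] mult.assoc)
  then have "sum f F \<le> (\<Sum>n\<in>F. ?h * exp (- (?r n)\<^sup>2 / 2))" by (rule sum_mono)
  also have "\<dots> = ?h * (\<Sum>n\<in>F. exp (- (?r n)\<^sup>2 / 2))" by (simp add: sum_distrib_left)
  also have "\<dots> \<le> ?h * ?B"
    using chol F r \<open>R \<ge> 0\<close>
    by (intro mult_left_mono gauss_lattice_tail_le) (auto simp: cholesky_factor_def rpow_nonneg)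
  finally show "sum f F \<le> (1 + sqrt (8 / pi)) * max 2 R ^ (CARD('g) - 1) * rpow (A + R\<^sup>2) (p / 2)
          * exp (- R\<^sup>2) * (\<Prod>j\<in>UNIV. 1 + sqrt (2 * pi) / C $ j $ j)"
    by (simp add: split[of "R\<^sup>2"] ac_simps)
qed

theorem theorem3p4:
  fixes \<tau> :: "complex^('g::{finite,linorder})^('g::{finite,linorder})"
    and C :: "real^('g::{finite,linorder})^('g::{finite,linorder})"
    and v :: "real^('g::{finite,linorder})"
    and R p :: real
  assumes "\<tau> \<in> siegel_space"
    and "cholesky_factor \<tau> C"
    and "R \<ge> 0"
    and "p \<ge> 0"
  shows "(\<forall>A::real. A \<ge> 0 \<and> A + R\<^sup>2 \<ge> p \<longrightarrow>
           (\<lambda>n. rpow (A + (tau_norm \<tau> (n - v))\<^sup>2) (p / 2) * exp (- (tau_norm \<tau> (n - v))\<^sup>2))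
             summable_on (int_vectors - ellipsoid v R \<tau>) \<and>
           (\<Sum>\<^sub>\<infinity>n\<in>int_vectors - ellipsoid v R \<tau>.
               rpow (A + (tau_norm \<tau> (n - v))\<^sup>2) (p / 2) * exp (- (tau_norm \<tau> (n - v))\<^sup>2))
             \<le> (1 + sqrt (8 / pi)) * max 2 R ^ (CARD('g) - 1) * rpow (A + R\<^sup>2) (p / 2)
                 * exp (- R\<^sup>2) * (\<Prod>j\<in>UNIV. 1 + sqrt (2 * pi) / C $ j $ j))
       \<and> (R\<^sup>2 \<ge> p \<longrightarrow>
           tail_term v p \<tau> summable_on (int_vectors - ellipsoid v R \<tau>) \<and>
           tail_sum v R p \<tau>
             \<le> (1 + sqrt (8 / pi)) * max 2 R ^ (CARD('g) - 1) * rpow R p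
                 * exp (- R\<^sup>2) * (\<Prod>j\<in>UNIV. 1 + sqrt (2 * pi) / C $ j $ j))"
proof -
  \<comment> \<open>The second claim is the case \<open>A = 0\<close>; halving the exponent of a
    square is valid because the norm and \<open>R\<close> are nonnegative.\<close>
  have "tail_term v p \<tau> =
      (\<lambda>n. rpow (0 + (tau_norm \<tau> (n - v))\<^sup>2) (p / 2) * exp (- (tau_norm \<tau> (n - v))\<^sup>2))"
    by (simp add: fun_eq_iff tail_term_def rpow_power2 tau_norm_cholesky[OF assms(2)])
  moreover have "rpow R p = rpow (0 + R\<^sup>2) (p / 2)"
    using assms(3) by (simp add: rpow_power2)
  ultimately show ?thesis
    unfolding tail_sum_def
    using theta_tail_bound[OF assms(2-4)] theta_tail_bound[OF assms(2-4), of 0]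
    by (simp only: add_0) auto
qed

end
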